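(* Fix an integer $r\ge2$ and a collection of non-negative integers $\boldsymbol\ell=\{\ell_{ij}\}_{1\le i<j\le r}$. Then $$1+\sum_{\boldsymbol n=(n_1,\dots,n_r)\in\mathbb{Z}_{\ge0}^r,\ \boldsymbol n\ne\boldsymbol0}(x-1)^{\kappa(\boldsymbol\ell,\boldsymbol n)}\,\mathrm{Tutte}\bigl(K^{(\boldsymbol\ell)}_{n_1,\dots,n_r},x,y\bigr)\frac{t_1^{n_1}}{n_1!}\cdots\frac{t_r^{n_r}}{n_r!}$$ $$=\left(\sum_{\boldsymbol m=(m_1,\dots,m_r)\in\mathbb{Z}_{\ge0}^r}y^{\sum_{1\le i<j\le r}\ell_{ij}m_im_j}(y-1)^{-|\boldsymbol m|}\frac{t_1^{m_1}}{m_1!}\cdots\frac{t_r^{m_r}}{m_r!}\right)^{(x-1)(y-1)},$$ where $\kappa(\boldsymbol\ell,\boldsymbol n)$ is the number of connected components of the graph $K^{(\boldsymbol\ell)}_{n_1,\dots,n_r}$.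
   Context: The $\boldsymbol\ell$-weighted complete multipartite graph $K^{(\boldsymbol\ell)}_{n_1,\dots,n_r}$ has vertex set the disjoint union of sets $S_1,\dots,S_r$ with $|S_j|=n_j$; for $i<j$, every $\alpha\in S_i$ and every $\beta\in S_j$ are joined by exactly $\ell_{ij}$ parallel edges, and there are no other edges. $\mathrm{Tutte}(\Gamma,x,y)=\sum_{A\subset E}(x-1)^{\kappa(A)-\kappa(E)}(y-1)^{\kappa(A)+|A|-|V|}$ is the Tutte polynomial of $\Gamma=(V,E)$ ($\kappa(A)$ is the number of connected components of $(V,A)$). $|\boldsymbol m|=m_1+\cdots+m_r$. The identity is one of formal power series in $t_1,\dots,t_r$; the power on the right is $\exp((x-1)(y-1)\log(\cdot))$, the base having constant term $1$. *)

theory Defs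
  imports
    "HOL-Library.Poly_Mapping"
    "HOL-Computational_Algebra.Formal_Power_Series"
begin

abbreviation lookup where "lookup \<equiv> Poly_Mapping.lookup"
abbreviation keys where "keys \<equiv> Poly_Mapping.keys"

section \<open>Multigraphs and the Tutte polynomial\<close>

record ('v, 'e) multigraph =
  verts :: "'v set"
  edges :: "'e set"
  ends :: "'e \<Rightarrow> 'v set"  \<comment> \<open>the one- or two-element set of end points of an edge\<close>

definition adjacency :: "('v, 'e) multigraph \<Rightarrow> 'e set \<Rightarrow> 'v rel" where
  "adjacency G A = {(u, v). \<exists>e\<in>A. ends G e = {u, v}}"

text \<open>The number of connected components of the spanning subgraph with edge set \<open>A\<close>: the
  components are the classes of vertices under connectedness by a path with edges in \<open>A\<close>.\<close>

definition num_components :: "('v, 'e) multigraph \<Rightarrow> 'e set \<Rightarrow> nat" where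
  "num_components G A = card (verts G // (adjacency G A)\<^sup>*)"

text \<open>Both exponents are non-negative integers for every finite multigraph, so the subtractions
  of natural numbers are not truncated.\<close>

definition tutte :: "('v, 'e) multigraph \<Rightarrow> 'a::comm_ring_1 \<Rightarrow> 'a \<Rightarrow> 'a" where
  "tutte G x y =
     (\<Sum>A\<in>Pow (edges G).
        (x - 1) ^ (num_components G A - num_components G (edges G)) *
        (y - 1) ^ (num_components G A + card A - card (verts G)))"

text \<open>The vertex \<open>(j, a)\<close> is the \<open>a\<close>-th element of the \<open>j\<close>-th part, and \<open>(\<alpha>, \<beta>, k)\<close> is the
  \<open>k\<close>-th of the parallel edges joining \<open>\<alpha>\<close> and \<open>\<beta>\<close>.  An edge lists its end point in the
  lower-numbered part first, so each edge occurs once and only the values \<open>l i j\<close> with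
  \<open>1 \<le> i < j \<le> r\<close> matter.\<close>

definition complete_multipartite ::
  "nat \<Rightarrow> (nat \<Rightarrow> nat \<Rightarrow> nat) \<Rightarrow> (nat \<Rightarrow> nat)
    \<Rightarrow> (nat \<times> nat, (nat \<times> nat) \<times> (nat \<times> nat) \<times> nat) multigraph" where
  "complete_multipartite r l n =
     (let V = (SIGMA j:{1..r}. {..<n j}) in
      \<lparr> verts = V,
        edges = {(\<alpha>, \<beta>, k). \<alpha> \<in> V \<and> \<beta> \<in> V \<and> fst \<alpha> < fst \<beta> \<and> k < l (fst \<alpha>) (fst \<beta>)},
        ends = (\<lambda>(\<alpha>, \<beta>, k). {\<alpha>, \<beta>}) \<rparr>)"

section \<open>Formal power series in several variables\<close>

text \<open>Power series in variables \<open>t\<^sub>v\<close> indexed by an arbitrary type, given by the coefficient of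
  each monomial; a monomial is its finitely supported exponent vector.\<close>

typedef ('v, 'a) mfps = "UNIV :: (('v \<Rightarrow>\<^sub>0 nat) \<Rightarrow> 'a) set"
  morphisms mfps_nth Abs_mfps
  by simp

lemma mfps_nth_Abs_mfps [simp]: "mfps_nth (Abs_mfps f) = f"
  by (simp add: Abs_mfps_inverse)

lemma mfps_eqI: "(\<And>n. mfps_nth f n = mfps_nth g n) \<Longrightarrow> f = g"
  by (simp add: mfps_nth_inject [symmetric] fun_eq_iff)

definition splittings :: "('v \<Rightarrow>\<^sub>0 nat) \<Rightarrow> (('v \<Rightarrow>\<^sub>0 nat) \<times> ('v \<Rightarrow>\<^sub>0 nat)) set" where
  "splittings n = {(k, l). k + l = n}"

lemma finite_splittings [simp, intro]: "finite (splittings (n :: 'v \<Rightarrow>\<^sub>0 nat))"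
proof -
  let ?F = "{f :: 'v \<Rightarrow> nat. \<forall>i. (i \<in> keys n \<longrightarrow> f i \<in> {..Max (lookup n ` keys n)}) \<and>
                             (i \<notin> keys n \<longrightarrow> f i = 0)}"
  have "finite ?F"
    by (rule finite_set_of_finite_funs) simp_all
  moreover have "lookup ` fst ` splittings n \<subseteq> ?F"
  proof clarify
    fix k l i assume "(k, l) \<in> splittings n"
    then have sum: "lookup n i = lookup k i + lookup l i"
      by (auto simp: splittings_def lookup_add)
    have "lookup k i \<le> Max (lookup n ` keys n)" if "i \<in> keys n"
    proof -
      have "lookup k i \<le> lookup n i" using sum by simp
      also have "\<dots> \<le> Max (lookup n ` keys n)" by (rule Max_ge) (use that in simp_all)
      finally show ?thesis .
    qed
    moreover have "lookup k i = 0" if "i \<notin> keys n"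
      using that sum by (simp add: in_keys_iff)
    ultimately show "(i \<in> keys n \<longrightarrow> lookup (fst (k, l)) i \<in> {..Max (lookup n ` keys n)}) \<and>
                     (i \<notin> keys n \<longrightarrow> lookup (fst (k, l)) i = 0)"
      unfolding fst_conv atMost_iff by blast
  qed
  ultimately have "finite (lookup ` fst ` splittings n)"
    by (rule rev_finite_subset)
  then have "finite (fst ` splittings n)"
    by (rule finite_imageD) (simp add: inj_on_def lookup_inject)
  moreover have "inj_on fst (splittings n)"
    by (auto simp: inj_on_def splittings_def)
  ultimately show ?thesis
    by (rule finite_imageD)
qed

instantiation mfps :: (type, comm_ring_1) comm_ring_1
begin

definition zero_mfps :: "('a, 'b) mfps" where
  "0 = Abs_mfps (\<lambda>_. 0)"

definition one_mfps :: "('a, 'b) mfps" where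
  "1 = Abs_mfps (\<lambda>n. if n = 0 then 1 else 0)"

definition plus_mfps :: "('a, 'b) mfps \<Rightarrow> ('a, 'b) mfps \<Rightarrow> ('a, 'b) mfps" where
  "f + g = Abs_mfps (\<lambda>n. mfps_nth f n + mfps_nth g n)"

definition uminus_mfps :: "('a, 'b) mfps \<Rightarrow> ('a, 'b) mfps" where
  "- f = Abs_mfps (\<lambda>n. - mfps_nth f n)"

definition minus_mfps :: "('a, 'b) mfps \<Rightarrow> ('a, 'b) mfps \<Rightarrow> ('a, 'b) mfps" where
  "f - g = Abs_mfps (\<lambda>n. mfps_nth f n - mfps_nth g n)"

definition times_mfps :: "('a, 'b) mfps \<Rightarrow> ('a, 'b) mfps \<Rightarrow> ('a, 'b) mfps" where
  "f * g = Abs_mfps (\<lambda>n. \<Sum>(k, l)\<in>splittings n. mfps_nth f k * mfps_nth g l)"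

instance
proof
  fix f g h :: "('a, 'b) mfps"
  show "f + g + h = f + (g + h)" "f + g = g + f" "0 + f = f" "- f + f = 0" "f - g = f + - g"
    by (simp_all add: plus_mfps_def zero_mfps_def uminus_mfps_def minus_mfps_def mfps_nth_inverse
        ac_simps)
  show "(f + g) * h = f * h + g * h"
    by (rule mfps_eqI)
      (simp add: plus_mfps_def times_mfps_def distrib_right sum.distrib split_def)
  show "f * g = g * f"
  proof (rule mfps_eqI)
    fix n
    have "(\<Sum>(k, l)\<in>splittings n. mfps_nth f k * mfps_nth g l) =
          (\<Sum>(k, l)\<in>splittings n. mfps_nth g k * mfps_nth f l)"
      by (rule sum.reindex_bij_witness [of _ prod.swap prod.swap])
        (auto simp: splittings_def add.commute mult.commute)
    then show "mfps_nth (f * g) n = mfps_nth (g * f) n"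
      by (simp add: times_mfps_def)
  qed
  show "1 * f = f"
  proof (rule mfps_eqI)
    fix n
    have "mfps_nth (1 * f) n =
          (\<Sum>p\<in>splittings n. (if fst p = 0 then 1 else 0) * mfps_nth f (snd p))"
      by (simp add: times_mfps_def one_mfps_def split_def)
    also have "\<dots> = (\<Sum>p\<in>{(0 :: 'a \<Rightarrow>\<^sub>0 nat, n)}. (if fst p = 0 then 1 else 0) * mfps_nth f (snd p))"
      by (rule sum.mono_neutral_right [OF finite_splittings]) (auto simp: splittings_def)
    finally show "mfps_nth (1 * f) n = mfps_nth f n" by simp
  qed
  show "f * g * h = f * (g * h)"
  proof (rule mfps_eqI)
    fix n
    have "mfps_nth (f * g * h) n =
          (\<Sum>(p, c)\<in>splittings n. \<Sum>(a, b)\<in>splittings p. mfps_nth f a * mfps_nth g b * mfps_nth h c)"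
      by (simp add: times_mfps_def split_def sum_distrib_right)
    also have "\<dots> = (\<Sum>((p, c), (a, b))\<in>(SIGMA u:splittings n. splittings (fst u)).
                     mfps_nth f a * mfps_nth g b * mfps_nth h c)"
      by (simp add: sum.Sigma split_def)
    also have "\<dots> = (\<Sum>((a, q), (b, c))\<in>(SIGMA u:splittings n. splittings (snd u)).
                     mfps_nth f a * (mfps_nth g b * mfps_nth h c))"
      by (rule sum.reindex_bij_witness
          [of _ "\<lambda>((a, q), (b, c)). ((a + b, c), (a, b))" "\<lambda>((p, c), (a, b)). ((a, b + c), (b, c))"])
        (auto simp: splittings_def add.assoc mult.assoc)
    also have "\<dots> = (\<Sum>(a, q)\<in>splittings n. \<Sum>(b, c)\<in>splittings q.
                     mfps_nth f a * (mfps_nth g b * mfps_nth h c))"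
      by (simp add: sum.Sigma split_def)
    also have "\<dots> = mfps_nth (f * (g * h)) n"
      by (simp add: times_mfps_def split_def sum_distrib_left)
    finally show "mfps_nth (f * g * h) n = mfps_nth (f * (g * h)) n" .
  qed
  show "(0::('a, 'b) mfps) \<noteq> 1"
    by (auto simp: zero_mfps_def one_mfps_def Abs_mfps_inject fun_eq_iff)
qed

end

definition mfps_const :: "'a::zero \<Rightarrow> ('v, 'a) mfps" where
  "mfps_const c = Abs_mfps (\<lambda>n. if n = 0 then c else 0)"

definition total_degree :: "('v \<Rightarrow>\<^sub>0 nat) \<Rightarrow> nat" where
  "total_degree n = (\<Sum>v\<in>keys n. lookup n v)"

text \<open>Substitution of \<open>g\<close> into a univariate series, as in \<^const>\<open>fps_compose\<close>.  It is meaningful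
  when \<open>g\<close> has constant term \<open>0\<close>; then \<open>g ^ i\<close> has no terms of degree less than \<open>i\<close>, so the
  finite sum below is the coefficient of the full infinite sum.\<close>

definition mfps_subst :: "'a::comm_ring_1 fps \<Rightarrow> ('v, 'a) mfps \<Rightarrow> ('v, 'a) mfps" where
  "mfps_subst F g = Abs_mfps (\<lambda>n. \<Sum>i\<le>total_degree n. fps_nth F i * mfps_nth (g ^ i) n)"

text \<open>\<^term>\<open>fps_ln 1\<close> is the series of \<open>log (1 + X)\<close>, so the logarithm and the power are meaningful
  for series with constant term \<open>1\<close>.\<close>

definition mfps_log :: "('v, 'a::field_char_0) mfps \<Rightarrow> ('v, 'a) mfps" where
  "mfps_log f = mfps_subst (fps_ln 1) (f - 1)"

definition mfps_exp :: "('v, 'a::field_char_0) mfps \<Rightarrow> ('v, 'a) mfps" where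
  "mfps_exp g = mfps_subst (fps_exp 1) g"

definition mfps_powr :: "('v, 'a::field_char_0) mfps \<Rightarrow> 'a \<Rightarrow> ('v, 'a) mfps" where
  "mfps_powr f c = mfps_exp (mfps_const c * mfps_log f)"

text \<open>Vectors \<open>(n\<^sub>1, \<dots>, n\<^sub>r)\<close> of natural numbers, as exponent vectors supported in \<open>{1..r}\<close>.\<close>

definition multi_indices :: "nat \<Rightarrow> (nat \<Rightarrow>\<^sub>0 nat) set" where
  "multi_indices r = {n. keys n \<subseteq> {1..r}}"

text \<open>The series \<open>\<Sum>n\<in>N. c n * (\<Prod>v. t\<^sub>v ^ n v / fact (n v))\<close>; factors with \<open>n v = 0\<close> are \<open>1\<close>.\<close>

definition exp_gen_series :: "('v \<Rightarrow>\<^sub>0 nat) set \<Rightarrow> (('v \<Rightarrow>\<^sub>0 nat) \<Rightarrow> 'a::field_char_0) \<Rightarrow> ('v, 'a) mfps" where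
  "exp_gen_series N c =
     Abs_mfps (\<lambda>n. if n \<in> N then c n / (\<Prod>v\<in>keys n. fact (lookup n v)) else 0)"

end

theory Submission
  imports Defs "HOL-Library.FuncSet" "HOL-Computational_Algebra.Polynomial"
begin

text \<open>Put \<open>q = (x - 1) (y - 1)\<close> and let \<open>f\<close> be the series on the right.  Up to the factor
  \<open>(y - 1) ^ card V\<close>, the left-hand coefficient is the Fortuin--Kasteleyn sum
  \<open>\<Sum>A. q ^ \<kappa>(A) * (y - 1) ^ card A\<close>, a polynomial in \<open>q\<close>.  For \<open>q = c\<close> a natural number,
  \<open>c ^ \<kappa>(A)\<close> counts the vertex colourings with \<open>c\<close> colours that are constant along the edges in
  \<open>A\<close>; exchanging the sums gives a sum over all colourings of \<open>y\<close> to the number of monochromatic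
  edges.  This weight is a product over the colour classes, so the generating function is \<open>f ^ c\<close>.
  The coefficients of the formal power of \<open>f\<close> with exponent \<open>q\<close> are polynomials in \<open>q\<close> as well, and
  two polynomials that agree at all natural numbers are equal.\<close>

section \<open>Substitution and powers of multivariate power series\<close>

lemma mfps_nth_simps [simp]:
  "mfps_nth 0 n = 0" "mfps_nth 1 n = (if n = 0 then 1 else 0)"
  "mfps_nth (f + g) n = mfps_nth f n + mfps_nth g n"
  "mfps_nth (f - g) n = mfps_nth f n - mfps_nth g n"
  by (simp_all add: zero_mfps_def one_mfps_def plus_mfps_def minus_mfps_def)

lemma mfps_nth_mult:
  "mfps_nth (f * g) n = (\<Sum>(k, l)\<in>splittings n. mfps_nth f k * mfps_nth g l)"
  by (simp add: times_mfps_def)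

lemma mfps_nth_const_mult [simp]:
  fixes n :: "'v \<Rightarrow>\<^sub>0 nat"
  shows "mfps_nth (mfps_const c * f) n = c * mfps_nth f n"
proof -
  have "mfps_nth (mfps_const c * f) n =
      (\<Sum>p\<in>splittings n. (if fst p = 0 then c else 0) * mfps_nth f (snd p))"
    by (simp add: mfps_nth_mult mfps_const_def split_def)
  also have "\<dots> = (\<Sum>p\<in>{(0 :: 'v \<Rightarrow>\<^sub>0 nat, n)}. (if fst p = 0 then c else 0) * mfps_nth f (snd p))"
    by (rule sum.mono_neutral_right [OF finite_splittings]) (auto simp: splittings_def)
  finally show ?thesis by simp
qed

lemma mfps_nth_const_mult_power:
  fixes f :: "('v, 'a::comm_ring_1) mfps"
  shows "mfps_nth ((mfps_const c * f) ^ i) n = c ^ i * mfps_nth (f ^ i) n"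
proof -
  have "(mfps_const c * f) ^ i = mfps_const (c ^ i) * f ^ i"
  proof (induction i)
    case 0
    then show ?case by (auto intro!: mfps_eqI simp: mfps_const_def)
  next
    case (Suc i)
    have const: "mfps_const (c * c ^ i) = mfps_const c * (mfps_const (c ^ i) :: ('v, 'a) mfps)"
      by (rule mfps_eqI) (simp, simp add: mfps_const_def)
    show ?case unfolding power_Suc Suc.IH const by (simp only: mult_ac)
  qed
  then show ?thesis by simp
qed

section \<open>Total degree, and truncation of substitutions by degree\<close>

lemma total_degree_superset:
  assumes "finite S" "keys n \<subseteq> S"
  shows "total_degree n = (\<Sum>v\<in>S. lookup n v)"
  unfolding total_degree_def
  by (rule sum.mono_neutral_left [OF assms]) (simp add: in_keys_iff)

lemma total_degree_0 [simp]: "total_degree 0 = 0"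
  by (simp add: total_degree_def)

lemma total_degree_single [simp]: "total_degree (Poly_Mapping.single v k) = k"
  by (cases "k = 0") (simp_all add: total_degree_def)

lemma total_degree_add: "total_degree (k + l) = total_degree k + total_degree l"
proof -
  let ?S = "keys k \<union> keys l"
  have "total_degree (k + l) = (\<Sum>v\<in>?S. lookup (k + l) v)"
    by (rule total_degree_superset) (use Poly_Mapping.keys_add [of k l] in auto)
  also have "\<dots> = (\<Sum>v\<in>?S. lookup k v) + (\<Sum>v\<in>?S. lookup l v)"
    by (simp add: lookup_add sum.distrib)
  also have "\<dots> = total_degree k + total_degree l"
    by (simp add: total_degree_superset [symmetric])
  finally show ?thesis .
qed

lemma total_degree_eq_0_iff [simp]: "total_degree n = 0 \<longleftrightarrow> n = 0"
  by (auto simp: total_degree_def in_keys_iff intro: poly_mapping_eqI)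

text \<open>Without a constant term every factor \<open>g\<close> contributes degree at least
  one.\<close>

lemma mfps_nth_power_eq_0:
  assumes "mfps_nth g 0 = 0" "total_degree n < i"
  shows "mfps_nth (g ^ i) n = 0"
  using assms(2)
proof (induction i arbitrary: n)
  case (Suc i)
  have "mfps_nth g k * mfps_nth (g ^ i) l = 0" if "(k, l) \<in> splittings n" for k l
  proof (cases "k = 0")
    case False
    then have "0 < total_degree k" by (metis gr0I total_degree_eq_0_iff)
    moreover have "total_degree k + total_degree l = total_degree n"
      using that by (auto simp: splittings_def total_degree_add)
    ultimately show ?thesis using Suc by simp
  qed (simp add: assms(1))
  then show ?case by (auto simp: mfps_nth_mult intro!: sum.neutral)
qed simp

text \<open>Further terms vanish by degree, so different monomials can share one truncation bound
  \<open>N\<close>.\<close>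

lemma mfps_nth_subst:
  assumes "mfps_nth g 0 = 0" "total_degree n \<le> N"
  shows "mfps_nth (mfps_subst F g) n = (\<Sum>i\<le>N. fps_nth F i * mfps_nth (g ^ i) n)"
  unfolding mfps_subst_def mfps_nth_Abs_mfps
  by (rule sum.mono_neutral_left) (use assms in \<open>auto simp: mfps_nth_power_eq_0\<close>)

lemma mfps_subst_nth_0 [simp]: "mfps_nth (mfps_subst F g) 0 = fps_nth F 0"
  by (simp add: mfps_subst_def)

lemma mfps_subst_1 [simp]: "mfps_subst 1 g = 1"
  by (rule mfps_eqI) (simp add: mfps_subst_def sum.atMost_shift)

lemma mfps_subst_1_plus_X:
  assumes "mfps_nth g 0 = 0"
  shows "mfps_subst (1 + fps_X) g = 1 + g"
proof (rule mfps_eqI)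
  fix n
  \<comment> \<open>The bound is raised by one so that the index 1 of \<open>fps_X\<close> is in
    range even for \<open>n = 0\<close>.\<close>
  have "mfps_nth (mfps_subst (1 + fps_X) g) n =
      (\<Sum>i\<le>Suc (total_degree n). fps_nth (1 + fps_X) i * mfps_nth (g ^ i) n)"
    by (rule mfps_nth_subst) (simp_all add: assms)
  also have "\<dots> = (\<Sum>i\<in>{0, 1}. fps_nth (1 + fps_X) i * mfps_nth (g ^ i) n)"
    by (rule sum.mono_neutral_right) (auto simp: fps_X_def)
  finally show "mfps_nth (mfps_subst (1 + fps_X) g) n = mfps_nth (1 + g) n" by simp
qed

text \<open>Multiplying the two substituted series and collecting the powers of \<open>g\<close> by
  \<open>s = i + j\<close> produces the Cauchy product coefficients of \<open>F * G\<close>.\<close>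

lemma mfps_subst_mult:
  fixes g :: "('v, 'a::comm_ring_1) mfps"
  assumes g: "mfps_nth g 0 = 0"
  shows "mfps_subst (F * G) g = mfps_subst F g * mfps_subst G g"
proof (rule mfps_eqI)
  fix n :: "'v \<Rightarrow>\<^sub>0 nat"
  define N where "N = total_degree n"
  let ?c = "\<lambda>i. fps_nth F i" and ?d = "\<lambda>i. fps_nth G i" and ?g = "\<lambda>i. mfps_nth (g ^ i)"
  have deg: "total_degree k \<le> N" "total_degree l \<le> N" if "(k, l) \<in> splittings n" for k l
    using that by (auto simp: splittings_def total_degree_add N_def)
  have "mfps_nth (mfps_subst F g * mfps_subst G g) n =
      (\<Sum>(k, l)\<in>splittings n. (\<Sum>i\<le>N. ?c i * ?g i k) * (\<Sum>j\<le>N. ?d j * ?g j l))"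
    unfolding mfps_nth_mult
    by (intro sum.cong refl) (auto simp: mfps_nth_subst [OF g, where N = N] deg)
  also have "\<dots> = (\<Sum>(k, l)\<in>splittings n. \<Sum>i\<le>N. \<Sum>j\<le>N. ?c i * ?d j * (?g i k * ?g j l))"
    by (simp add: sum_product mult_ac)
  also have "\<dots> = (\<Sum>i\<le>N. \<Sum>j\<le>N. \<Sum>(k, l)\<in>splittings n. ?c i * ?d j * (?g i k * ?g j l))"
    unfolding split_def by (subst sum.swap, intro sum.cong refl, subst sum.swap, rule refl)
  also have "\<dots> = (\<Sum>i\<le>N. \<Sum>j\<le>N. ?c i * ?d j * ?g (i + j) n)"
    by (simp add: power_add mfps_nth_mult sum_distrib_left split_def)
  also have "\<dots> = (\<Sum>(i, j)\<in>{..N} \<times> {..N}. ?c i * ?d j * ?g (i + j) n)"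
    by (simp add: sum.cartesian_product)
  \<comment> \<open>The square shrinks to a triangle: for \<open>i + j > N\<close> the power
    \<open>g ^ (i + j)\<close> has no coefficient at \<open>n\<close>.\<close>
  also have "\<dots> = (\<Sum>(i, j)\<in>{(i, j). i + j \<le> N}. ?c i * ?d j * ?g (i + j) n)"
  proof (rule sum.mono_neutral_right)
    show "\<forall>p\<in>{..N} \<times> {..N} - {(i, j). i + j \<le> N}.
        (case p of (i, j) \<Rightarrow> ?c i * ?d j * ?g (i + j) n) = 0"
    proof
      fix p assume "p \<in> {..N} \<times> {..N} - {(i, j). i + j \<le> N}"
      then obtain i j where "p = (i, j)" "N < i + j" by (cases p) auto
      then show "(case p of (i, j) \<Rightarrow> ?c i * ?d j * ?g (i + j) n) = 0"
        by (simp add: N_def mfps_nth_power_eq_0 [OF g])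
    qed
  qed auto
  also have "\<dots> = (\<Sum>s\<le>N. \<Sum>i\<le>s. ?c i * ?d (s - i) * ?g s n)"
    by (subst sum.triangle_reindex_eq) simp
  also have "\<dots> = mfps_nth (mfps_subst (F * G) g) n"
    by (simp add: mfps_subst_def N_def fps_mult_nth sum_distrib_right atLeast0AtMost)
  finally show "mfps_nth (mfps_subst (F * G) g) n = mfps_nth (mfps_subst F g * mfps_subst G g) n" ..
qed

lemma mfps_subst_power:
  "mfps_nth g 0 = 0 \<Longrightarrow> mfps_subst (F ^ i) g = mfps_subst F g ^ i"
  by (induction i) (simp_all add: mfps_subst_mult)

lemma mfps_subst_compose:
  fixes g :: "('v, 'a::comm_ring_1) mfps"
  assumes g: "mfps_nth g 0 = 0" and G: "fps_nth G 0 = 0"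
  shows "mfps_subst F (mfps_subst G g) = mfps_subst (F oo G) g"
proof (rule mfps_eqI)
  fix n :: "'v \<Rightarrow>\<^sub>0 nat"
  define N where "N = total_degree n"
  have "mfps_nth (mfps_subst F (mfps_subst G g)) n =
      (\<Sum>i\<le>N. fps_nth F i * mfps_nth (mfps_subst (G ^ i) g) n)"
    by (simp add: mfps_subst_def [of F] mfps_subst_power [OF g] N_def)
  also have "\<dots> = (\<Sum>i\<le>N. \<Sum>j\<le>N. fps_nth F i * fps_nth (G ^ i) j * mfps_nth (g ^ j) n)"
    by (simp add: mfps_subst_def [of "_ ^ _"] N_def sum_distrib_left mult_ac)
  also have "\<dots> = (\<Sum>j\<le>N. \<Sum>i\<le>N. fps_nth F i * fps_nth (G ^ i) j * mfps_nth (g ^ j) n)"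
    by (rule sum.swap)
  \<comment> \<open>\<open>G ^ i\<close> has no coefficient below degree \<open>i\<close>, so
    \<open>i\<close> may stop at \<open>j\<close>, the range used by
    \<open>fps_compose\<close>.\<close>
  also have "\<dots> = (\<Sum>j\<le>N. \<Sum>i\<in>{0..j}. fps_nth F i * fps_nth (G ^ i) j * mfps_nth (g ^ j) n)"
    by (intro sum.cong refl sum.mono_neutral_right)
      (use G in \<open>auto simp: startsby_zero_power_prefix\<close>)
  also have "\<dots> = mfps_nth (mfps_subst (F oo G) g) n"
    by (simp add: mfps_subst_def N_def fps_compose_nth sum_distrib_right)
  finally show "mfps_nth (mfps_subst F (mfps_subst G g)) n = mfps_nth (mfps_subst (F oo G) g) n" .
qed

section \<open>Formal powers through exponential and logarithm\<close>

lemma fps_exp_compose_ln: "fps_exp (1::'a::field_char_0) oo fps_ln 1 = 1 + fps_X"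
proof -
  \<comment> \<open>Compositional inversion applies to \<open>fps_exp 1 - 1\<close>, which has
    constant term 0; the 1 is restored afterwards.\<close>
  have "(fps_exp 1 - 1) oo fps_ln (1::'a) = fps_X"
    by (simp add: fps_ln_fps_exp_inv fps_inv_fps_exp_compose)
  then show ?thesis
    by (simp add: fps_compose_sub_distrib algebra_simps)
qed

text \<open>Moves the exponent into the coefficients \<open>c ^ i / fact i\<close> of
  \<open>fps_exp c\<close>, which makes the polynomial dependence on \<open>c\<close>
  visible.\<close>

lemma mfps_powr_eq_subst: "mfps_powr f c = mfps_subst (fps_exp c) (mfps_log f)"
  unfolding mfps_powr_def mfps_exp_def
  by (rule mfps_eqI) (simp add: mfps_subst_def mfps_nth_const_mult_power mult_ac)

text \<open>Exponent 1 gives back \<open>f\<close> because exp inverts log; the general case follows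
  since \<open>fps_exp (of_nat c)\<close> is the \<open>c\<close>-th power of
  \<open>fps_exp 1\<close> and substitution respects powers.\<close>

lemma mfps_powr_of_nat:
  fixes f :: "('v, 'a::field_char_0) mfps"
  assumes "mfps_nth f 0 = 1"
  shows "mfps_powr f (of_nat c) = f ^ c"
proof -
  have log0: "mfps_nth (mfps_log f) 0 = 0"
    by (simp add: mfps_log_def)
  have "mfps_powr f 1 = f"
    by (simp add: mfps_powr_eq_subst mfps_log_def mfps_subst_compose assms
        fps_exp_compose_ln mfps_subst_1_plus_X)
  moreover have "fps_exp (of_nat c :: 'a) = fps_exp 1 ^ c"
    by (simp add: fps_exp_power_mult)
  ultimately show ?thesis
    by (simp add: mfps_powr_eq_subst mfps_subst_power [OF log0])
qed

text \<open>Every coefficient of \<open>f\<^sup>q\<close> is a polynomial in \<open>q\<close>, so it is determined by its values at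
  the natural numbers.\<close>

lemma mfps_nth_powr_eqI:
  fixes f :: "('v, 'a::field_char_0) mfps"
  assumes f: "mfps_nth f 0 = 1"
    and p: "\<And>c. mfps_nth (f ^ c) n = poly p (of_nat c)"
  shows "mfps_nth (mfps_powr f q) n = poly p q"
proof -
  define p' where "p' = (\<Sum>i\<le>total_degree n.
    monom (mfps_nth (mfps_log f ^ i) n / fact i) i)"
  have p': "mfps_nth (mfps_powr f q) n = poly p' q" for q
    by (simp add: mfps_powr_eq_subst mfps_subst_def p'_def poly_sum poly_monom mult_ac)
  have "poly p' (of_nat c) = poly p (of_nat c)" for c
    by (simp add: p' [symmetric] p [symmetric] mfps_powr_of_nat [OF f])
  then have "range of_nat \<subseteq> {q. poly (p' - p) q = 0}"
    by auto
  moreover have "infinite (range (of_nat :: nat \<Rightarrow> 'a))"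
    by (simp add: range_inj_infinite)
  ultimately have "p' - p = 0"
    using poly_roots_finite finite_subset by blast
  with p' show ?thesis by simp
qed

section \<open>Colourings and powers of exponential generating series\<close>

text \<open>The exponent vector of the monomial in which each \<open>u\<close> in \<open>B\<close>
  contributes the variable with index \<open>\<pi> u\<close>. For the graph, \<open>\<pi>\<close> is
  \<open>fst\<close>, and the entries count the vertices of \<open>B\<close> in each part.\<close>

definition profile :: "('b \<Rightarrow> 'v) \<Rightarrow> 'b set \<Rightarrow> ('v \<Rightarrow>\<^sub>0 nat)" where
  "profile \<pi> B = (\<Sum>u\<in>B. Poly_Mapping.single (\<pi> u) 1)"

lemma lookup_sum: "lookup (\<Sum>u\<in>B. h u) j = (\<Sum>u\<in>B. lookup (h u) j)"
  by (induction B rule: infinite_finite_induct) (simp_all add: lookup_add)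

lemma lookup_profile:
  assumes "finite B"
  shows "lookup (profile \<pi> B) j = card {u\<in>B. \<pi> u = j}"
proof -
  have "lookup (profile \<pi> B) j = (\<Sum>u\<in>B. if \<pi> u = j then 1 else 0)"
    by (simp add: profile_def lookup_sum lookup_single when_def del: One_nat_def)
  also have "\<dots> = card {u\<in>B. \<pi> u = j}"
    using assms by (simp add: sum.If_cases Int_def)
  finally show ?thesis .
qed

lemma keys_profile: "finite B \<Longrightarrow> keys (profile \<pi> B) = \<pi> ` B"
  by (auto simp: in_keys_iff lookup_profile card_eq_0_iff)

lemma total_degree_profile: "finite B \<Longrightarrow> total_degree (profile \<pi> B) = card B"
  unfolding profile_def
  by (induction B rule: finite_induct) (simp_all add: total_degree_add)

lemma profile_add_diff:
  "finite V \<Longrightarrow> B \<subseteq> V \<Longrightarrow> profile \<pi> B + profile \<pi> (V - B) = profile \<pi> V"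
  unfolding profile_def by (metis add.commute sum.subset_diff)

definition mfact :: "('v \<Rightarrow>\<^sub>0 nat) \<Rightarrow> 'a::field_char_0" where
  "mfact n = (\<Prod>v\<in>keys n. fact (lookup n v))"

lemma mfact_nonzero [simp]: "mfact n \<noteq> 0"
  by (simp add: mfact_def)

lemma mfact_superset:
  assumes "finite S" "keys n \<subseteq> S"
  shows "mfact n = (\<Prod>v\<in>S. fact (lookup n v))"
  unfolding mfact_def
  by (rule prod.mono_neutral_left [OF assms]) (simp add: in_keys_iff)

text \<open>A subset is chosen independently inside each fibre of \<open>\<pi>\<close>, which gives
  a product of binomial coefficients.\<close>

lemma card_subsets_profile:
  assumes V: "finite V" and kl: "k + l = profile \<pi> V"
  shows "of_nat (card {B. B \<subseteq> V \<and> profile \<pi> B = k}) = (mfact (profile \<pi> V) / (mfact k * mfact l) :: 'a::field_char_0)"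
proof -
  define J where "J = \<pi> ` V"
  define P where "P = (\<lambda>j. {u\<in>V. \<pi> u = j})"
  have J: "finite J" and P: "finite (P j)" for j using V by (auto simp: J_def P_def)
  have card_P: "card (P j) = lookup k j + lookup l j" for j
    using arg_cong [OF kl, of "\<lambda>n. lookup n j"] V by (simp add: lookup_add lookup_profile P_def)
  \<comment> \<open>Both summands vanish where their sum does, so nothing outside \<open>J\<close>
    constrains \<open>B\<close>.\<close>
  have outside: "lookup k j = 0" "lookup l j = 0" if "j \<notin> J" for j
  proof -
    have "P j = {}" using that by (auto simp: P_def J_def)
    with card_P [of j] show "lookup k j = 0" "lookup l j = 0" by simp_all
  qed
  have keys: "keys k \<subseteq> J" "keys l \<subseteq> J" "keys (profile \<pi> V) \<subseteq> J"
    using outside V by (auto simp: in_keys_iff keys_profile J_def [symmetric])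
  \<comment> \<open>The admissible traces of \<open>B\<close> on the fibre \<open>P j\<close>;
    \<open>B\<close> is recovered as their union.\<close>
  define T where "T = (\<lambda>j. {C. C \<subseteq> P j \<and> card C = lookup k j})"
  have "bij_betw (\<lambda>B. \<lambda>j\<in>J. {u\<in>B. \<pi> u = j}) {B. B \<subseteq> V \<and> profile \<pi> B = k} (Pi\<^sub>E J T)"
  proof (rule bij_betw_byWitness [where f' = "\<lambda>g. \<Union>j\<in>J. g j"])
    show "\<forall>B\<in>{B. B \<subseteq> V \<and> profile \<pi> B = k}. (\<Union>j\<in>J. (\<lambda>j\<in>J. {u\<in>B. \<pi> u = j}) j) = B"
      by (auto simp: J_def)
    have "{u \<in> (\<Union>j\<in>J. g j). \<pi> u = j} = g j" if "g \<in> Pi\<^sub>E J T" "j \<in> J" for g j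
      using that by (fastforce simp: T_def P_def PiE_iff)
    then show "\<forall>g\<in>Pi\<^sub>E J T. (\<lambda>j\<in>J. {u \<in> (\<Union>j\<in>J. g j). \<pi> u = j}) = g"
      by (auto intro!: extensionalityI [of _ J] simp: PiE_iff)
    show "(\<lambda>B. \<lambda>j\<in>J. {u\<in>B. \<pi> u = j}) ` {B. B \<subseteq> V \<and> profile \<pi> B = k} \<subseteq> Pi\<^sub>E J T"
      using V by (auto simp: T_def P_def lookup_profile finite_subset)
    show "(\<lambda>g. \<Union>j\<in>J. g j) ` Pi\<^sub>E J T \<subseteq> {B. B \<subseteq> V \<and> profile \<pi> B = k}"
    proof clarify
      fix g assume g: "g \<in> Pi\<^sub>E J T"
      let ?B = "\<Union>j\<in>J. g j"
      have sub: "?B \<subseteq> V" using g by (fastforce simp: T_def P_def PiE_iff)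
      have "lookup (profile \<pi> ?B) j = lookup k j" for j
      proof (cases "j \<in> J")
        case True
        then have "{u \<in> ?B. \<pi> u = j} = g j"
          using g by (fastforce simp: T_def P_def PiE_iff)
        moreover have "card (g j) = lookup k j"
          using g True by (auto simp: T_def PiE_iff)
        ultimately show ?thesis
          using V sub by (simp only: lookup_profile finite_subset)
      next
        case False
        then have "{u \<in> ?B. \<pi> u = j} = {}" using sub by (auto simp: J_def)
        with outside [OF False] show ?thesis
          using V sub by (simp only: lookup_profile finite_subset card.empty)
      qed
      with sub show "?B \<subseteq> V \<and> profile \<pi> ?B = k"
        by (blast intro: poly_mapping_eqI)
    qed
  qed
  then have "card {B. B \<subseteq> V \<and> profile \<pi> B = k} = card (Pi\<^sub>E J T)"
    by (rule bij_betw_same_card)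
  also have "\<dots> = (\<Prod>j\<in>J. (lookup k j + lookup l j) choose lookup k j)"
    by (simp add: card_PiE J T_def n_subsets P card_P)
  also have "of_nat \<dots> = (\<Prod>j\<in>J. fact (lookup (profile \<pi> V) j) / (fact (lookup k j) * fact (lookup l j)) :: 'a)"
    by (simp add: binomial_fact kl [symmetric] lookup_add)
  also have "\<dots> = mfact (profile \<pi> V) / (mfact k * mfact l)"
    by (simp add: mfact_superset [OF J] keys prod_dividef prod.distrib)
  finally show ?thesis .
qed

text \<open>The weights count the subsets with a given profile. When \<open>h k l\<close> is a
  product, the right-hand side is a coefficient of a product of exponential generating
  series.\<close>

lemma sum_subsets_profile:
  fixes h :: "('v \<Rightarrow>\<^sub>0 nat) \<Rightarrow> ('v \<Rightarrow>\<^sub>0 nat) \<Rightarrow> 'a::field_char_0"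
  assumes V: "finite V"
  shows "(\<Sum>B\<in>Pow V. h (profile \<pi> B) (profile \<pi> (V - B)))
    = mfact (profile \<pi> V) * (\<Sum>(k, l)\<in>splittings (profile \<pi> V). h k l / (mfact k * mfact l))"
proof -
  let ?n = "profile \<pi> V"
  let ?s = "\<lambda>B. (profile \<pi> B, profile \<pi> (V - B))"
  have sub: "?s ` Pow V \<subseteq> splittings ?n"
    by (auto simp: splittings_def profile_add_diff V)
  have "(\<Sum>B\<in>Pow V. h (profile \<pi> B) (profile \<pi> (V - B)))
      = (\<Sum>p\<in>splittings ?n. \<Sum>B\<in>{B\<in>Pow V. ?s B = p}. h (profile \<pi> B) (profile \<pi> (V - B)))"
    using V by (intro sum.group [symmetric] sub) auto
  also have "\<dots> = (\<Sum>(k, l)\<in>splittings ?n. mfact ?n * (h k l / (mfact k * mfact l)))"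
  proof (intro sum.cong refl, clarify)
    fix k l assume "(k, l) \<in> splittings ?n"
    then have kl: "k + l = ?n" by (simp add: splittings_def)
    have "profile \<pi> (V - B) = l" if "B \<subseteq> V" "profile \<pi> B = k" for B
      using profile_add_diff [OF V that(1), of \<pi>] kl that(2) by (metis add_left_cancel)
    then have eq: "{B\<in>Pow V. ?s B = (k, l)} = {B. B \<subseteq> V \<and> profile \<pi> B = k}" by auto
    have "(\<Sum>B\<in>{B\<in>Pow V. ?s B = (k, l)}. h (profile \<pi> B) (profile \<pi> (V - B)))
        = (\<Sum>B\<in>{B\<in>Pow V. ?s B = (k, l)}. h k l)"
      by (intro sum.cong) auto
    also have "\<dots> = of_nat (card {B. B \<subseteq> V \<and> profile \<pi> B = k}) * h k l"
      unfolding eq by simp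
    also have "\<dots> = mfact ?n * (h k l / (mfact k * mfact l))"
      by (simp add: card_subsets_profile [OF V kl])
    finally show "(\<Sum>B\<in>{B\<in>Pow V. ?s B = (k, l)}. h (profile \<pi> B) (profile \<pi> (V - B)))
        = mfact ?n * (h k l / (mfact k * mfact l))" .
  qed
  finally show ?thesis by (simp add: sum_distrib_left split_def)
qed

text \<open>Splitting off one colour class at a time turns the sum over colourings into a power.\<close>

lemma sum_colourings:
  fixes w :: "('v \<Rightarrow>\<^sub>0 nat) \<Rightarrow> 'a::field_char_0"
  assumes "finite V"
  shows "(\<Sum>\<sigma>\<in>V \<rightarrow>\<^sub>E {..<c}. \<Prod>a<c. w (profile \<pi> {u\<in>V. \<sigma> u = a}))
    = mfact (profile \<pi> V) * mfps_nth (Abs_mfps (\<lambda>n. w n / mfact n) ^ c) (profile \<pi> V)"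
  using assms
proof (induction c arbitrary: V)
  case 0
  \<comment> \<open>Without colours there is one colouring if \<open>V\<close> is empty and none
    otherwise, matching the coefficients of the series 1.\<close>
  have "(profile \<pi> V = 0) = (V = {})"
    using 0 by (metis card_0_eq total_degree_eq_0_iff total_degree_profile)
  moreover have "V \<rightarrow>\<^sub>E ({} :: nat set) = {}" if "V \<noteq> {}"
    using that by (auto simp: PiE_eq_empty_iff)
  ultimately show ?case by (cases "V = {}") (simp_all add: mfact_def)
next
  case (Suc c)
  let ?f = "Abs_mfps (\<lambda>n. w n / mfact n)"
  let ?R = "\<lambda>V c. \<Sum>\<sigma>\<in>V \<rightarrow>\<^sub>E {..<c}. \<Prod>a<c. w (profile \<pi> {u\<in>V. \<sigma> u = a})"
  \<comment> \<open>The last colour \<open>c\<close> is singled out: \<open>B\<close> is its class,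
    and \<open>\<tau>\<close> colours the remaining vertices with the colours below
    \<open>c\<close>.\<close>
  have "?R V (Suc c) = (\<Sum>(B, \<tau>)\<in>(SIGMA B:Pow V. (V - B) \<rightarrow>\<^sub>E {..<c}).
      w (profile \<pi> B) * (\<Prod>a<c. w (profile \<pi> {u\<in>V - B. \<tau> u = a})))"
  proof (rule sum.reindex_bij_witness [where
        i = "\<lambda>(B, \<tau>). \<lambda>u\<in>V. if u \<in> B then c else \<tau> u" and
        j = "\<lambda>\<sigma>. ({u\<in>V. \<sigma> u = c}, restrict \<sigma> (V - {u\<in>V. \<sigma> u = c}))"])
    fix \<sigma> assume \<sigma>: "\<sigma> \<in> V \<rightarrow>\<^sub>E {..<Suc c}"
    let ?j = "({u\<in>V. \<sigma> u = c}, restrict \<sigma> (V - {u\<in>V. \<sigma> u = c}))"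
    show "(case ?j of (B, \<tau>) \<Rightarrow> \<lambda>u\<in>V. if u \<in> B then c else \<tau> u) = \<sigma>"
      using \<sigma> by (auto simp: fun_eq_iff PiE_def extensional_def)
    show "?j \<in> (SIGMA B:Pow V. (V - B) \<rightarrow>\<^sub>E {..<c})"
      using \<sigma> by (auto simp: PiE_iff less_Suc_eq)
    have "{u \<in> V - {u\<in>V. \<sigma> u = c}. restrict \<sigma> (V - {u\<in>V. \<sigma> u = c}) u = a} = {u\<in>V. \<sigma> u = a}"
      if "a < c" for a using that by auto
    then show "(case ?j of (B, \<tau>) \<Rightarrow> w (profile \<pi> B) *
        (\<Prod>a<c. w (profile \<pi> {u\<in>V - B. \<tau> u = a}))) = (\<Prod>a<Suc c. w (profile \<pi> {u\<in>V. \<sigma> u = a}))"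
      by (simp add: mult.commute)
  next
    fix b assume "b \<in> (SIGMA B:Pow V. (V - B) \<rightarrow>\<^sub>E {..<c})"
    then obtain B \<tau> where b: "b = (B, \<tau>)" and B: "B \<subseteq> V" and \<tau>: "\<tau> \<in> (V - B) \<rightarrow>\<^sub>E {..<c}"
      by auto
    let ?\<sigma> = "\<lambda>u\<in>V. if u \<in> B then c else \<tau> u"
    have "\<tau> u < c" if "u \<in> V - B" for u
      using PiE_mem [OF \<tau> that] by simp
    then have "{u\<in>V. ?\<sigma> u = c} = B"
      using B by auto
    moreover have "restrict ?\<sigma> (V - B) = \<tau>"
      using B \<tau> by (auto simp: fun_eq_iff PiE_def extensional_def)
    ultimately show "({u\<in>V. (case b of (B, \<tau>) \<Rightarrow> \<lambda>u\<in>V. if u \<in> B then c else \<tau> u) u = c},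
        restrict (case b of (B, \<tau>) \<Rightarrow> \<lambda>u\<in>V. if u \<in> B then c else \<tau> u)
          (V - {u\<in>V. (case b of (B, \<tau>) \<Rightarrow> \<lambda>u\<in>V. if u \<in> B then c else \<tau> u) u = c})) = b"
      by (simp only: b prod.case)
    show "(case b of (B, \<tau>) \<Rightarrow> \<lambda>u\<in>V. if u \<in> B then c else \<tau> u) \<in> V \<rightarrow>\<^sub>E {..<Suc c}"
      using B \<tau> by (auto simp: b PiE_iff less_Suc_eq)
  qed
  also have "\<dots> = (\<Sum>B\<in>Pow V. w (profile \<pi> B) * ?R (V - B) c)"
    using Suc.prems by (subst sum.Sigma [symmetric]) (auto simp: sum_distrib_left finite_PiE)
  also have "\<dots> = (\<Sum>B\<in>Pow V. (\<lambda>k l. w k * (mfact l * mfps_nth (?f ^ c) l))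
      (profile \<pi> B) (profile \<pi> (V - B)))"
    using Suc.prems by (intro sum.cong refl) (simp only: Suc.IH finite_Diff)
  also have "\<dots> = mfact (profile \<pi> V) * mfps_nth (?f ^ Suc c) (profile \<pi> V)"
    by (subst sum_subsets_profile [OF Suc.prems]) (simp add: mfps_nth_mult split_def mult_ac)
  finally show ?case .
qed

section \<open>The Fortuin--Kasteleyn expansion\<close>

locale finite_multigraph =
  fixes G :: "('v, 'e) multigraph"
  assumes finite_verts: "finite (verts G)"
    and finite_edges: "finite (edges G)"
    and ends: "e \<in> edges G \<Longrightarrow> \<exists>u\<in>verts G. \<exists>v\<in>verts G. ends G e = {u, v}"
begin

section \<open>Connected components of spanning subgraphs\<close>

lemma adjacency_insert:
  "ends G e = {u, v} \<Longrightarrow> adjacency G (insert e A) = insert (u, v) (insert (v, u) (adjacency G A))"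
  by (auto simp: adjacency_def doubleton_eq_iff)

lemma equiv_connected: "equiv UNIV ((adjacency G A)\<^sup>*)"
proof (rule equivI)
  have "sym (adjacency G A)" by (auto simp: sym_def adjacency_def insert_commute)
  then show "sym ((adjacency G A)\<^sup>*)" by (rule sym_rtrancl)
qed (auto simp: refl_rtrancl trans_rtrancl)

lemma connected_class_eq_iff:
  "(adjacency G A)\<^sup>* `` {u} = (adjacency G A)\<^sup>* `` {v} \<longleftrightarrow> (u, v) \<in> (adjacency G A)\<^sup>*"
  using eq_equiv_class_iff [OF equiv_connected] by simp

lemma connected_sym: "(u, v) \<in> (adjacency G A)\<^sup>* \<Longrightarrow> (v, u) \<in> (adjacency G A)\<^sup>*"
  by (metis connected_class_eq_iff)

lemma finite_components: "finite (verts G // R)"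
  using finite_verts by (simp add: quotient_def)

lemma connected_in_verts:
  assumes "A \<subseteq> edges G" "(u, v) \<in> (adjacency G A)\<^sup>*" "u \<in> verts G"
  shows "v \<in> verts G"
  using assms(2,3)
proof induction
  case (step v w)
  then obtain e where "e \<in> edges G" "ends G e = {v, w}"
    using assms(1) by (auto simp: adjacency_def)
  with ends [of e] show ?case by (auto simp: doubleton_eq_iff)
qed

lemma num_components_empty [simp]: "num_components G {} = card (verts G)"
proof -
  have "verts G // (adjacency G {})\<^sup>* = (\<lambda>u. {u}) ` verts G"
    by (auto simp: adjacency_def quotient_def)
  then show ?thesis by (simp add: num_components_def card_image)
qed

text \<open>Each component for \<open>A\<close> lies inside one for \<open>B\<close>, so closing
  under paths in \<open>B\<close> maps the former components onto the latter.\<close>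

lemma components_image:
  assumes "A \<subseteq> B"
  shows "verts G // (adjacency G B)\<^sup>* = (\<lambda>X. (adjacency G B)\<^sup>* `` X) ` (verts G // (adjacency G A)\<^sup>*)"
proof -
  have "(adjacency G A)\<^sup>* \<subseteq> (adjacency G B)\<^sup>*"
    by (rule rtrancl_mono) (use assms in \<open>auto simp: adjacency_def\<close>)
  then have "(adjacency G B)\<^sup>* `` ((adjacency G A)\<^sup>* `` {u}) = (adjacency G B)\<^sup>* `` {u}" for u
    by (auto intro: rtrancl_trans)
  then show ?thesis by (auto simp: quotient_def)
qed

lemma num_components_antimono: "A \<subseteq> B \<Longrightarrow> num_components G B \<le> num_components G A"
  unfolding num_components_def components_image [of A B]
  by (rule card_image_le [OF finite_components])

text \<open>A new edge can only merge the class of one end with that of the other, so at most one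
  component is lost.\<close>

lemma num_components_insert:
  assumes "e \<in> edges G"
  shows "num_components G A \<le> Suc (num_components G (insert e A))"
proof -
  let ?R = "(adjacency G A)\<^sup>*" and ?S = "(adjacency G (insert e A))\<^sup>*"
  obtain u v where u: "u \<in> verts G" and e: "ends G e = {u, v}"
    using ends [OF assms] by auto
  have S: "?S = (insert (u, v) (insert (v, u) (adjacency G A)))\<^sup>*"
    by (simp add: adjacency_insert [OF e])
  \<comment> \<open>A path that needs the new edge can be shortened to cross it once; then
    \<open>a\<close> or \<open>b\<close> is already joined to \<open>u\<close> in the old
    graph.\<close>
  have new: "(a, b) \<in> ?R \<or> (u, a) \<in> ?R \<or> (u, b) \<in> ?R" if "(a, b) \<in> ?S" for a b
    using that connected_sym [of a u A] rtrancl_trans [of a v "adjacency G A" b]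
    unfolding S rtrancl_insert by auto
  have RS: "?R \<subseteq> ?S"
    by (rule rtrancl_mono) (auto simp: adjacency_def)
  \<comment> \<open>Distinct old classes merge only if one of them is the class of \<open>u\<close>;
    with that class removed, the map to the new classes is injective.\<close>
  have "inj_on (\<lambda>X. ?S `` X) (verts G // ?R - {?R `` {u}})"
  proof (rule inj_onI)
    fix X Y assume X: "X \<in> verts G // ?R - {?R `` {u}}" and Y: "Y \<in> verts G // ?R - {?R `` {u}}"
      and eq: "?S `` X = ?S `` Y"
    obtain a b where a: "X = ?R `` {a}" and b: "Y = ?R `` {b}"
      using X Y by (auto simp: quotient_def)
    have "b \<in> ?S `` X" unfolding eq b by auto
    then have "(a, b) \<in> ?S" unfolding a using RS by (auto intro: rtrancl_trans)
    moreover have "(u, a) \<notin> ?R" "(u, b) \<notin> ?R"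
      using X Y unfolding a b by (auto simp: connected_class_eq_iff dest: connected_sym)
    ultimately have "(a, b) \<in> ?R" using new by blast
    then show "X = Y" unfolding a b by (simp add: connected_class_eq_iff)
  qed
  then have "card (verts G // ?R - {?R `` {u}}) = card ((\<lambda>X. ?S `` X) ` (verts G // ?R - {?R `` {u}}))"
    by (simp add: card_image)
  also have "\<dots> \<le> card (verts G // ?S)"
    unfolding components_image [of A "insert e A", OF subset_insertI]
    by (intro card_mono finite_imageI finite_components) auto
  finally show ?thesis
    using u by (simp add: num_components_def card_Diff_singleton quotientI finite_components)
qed

text \<open>Starting from isolated vertices, each added edge lowers the number of components by at
  most one. Hence the second exponent in \<open>tutte\<close> is not truncated.\<close>

lemma card_verts_le:
  assumes "A \<subseteq> edges G"
  shows "card (verts G) \<le> num_components G A + card A"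
  using finite_subset [OF assms finite_edges] assms
proof (induction A rule: finite_induct)
  case (insert e A)
  then show ?case using num_components_insert [of e A] by simp
qed simp

text \<open>The outer factors cancel what is subtracted in the two exponents of
  \<open>tutte\<close>, leaving \<open>x - 1\<close> and \<open>y - 1\<close> with the common
  exponent \<open>num_components G A\<close>.\<close>

lemma tutte_eq_sum:
  fixes x y :: "'a::comm_ring_1"
  shows "(x - 1) ^ num_components G (edges G) * tutte G x y * (y - 1) ^ card (verts G)
    = (\<Sum>A\<in>Pow (edges G). ((x - 1) * (y - 1)) ^ num_components G A * (y - 1) ^ card A)"
proof -
  let ?k = "num_components G"
  have "(x - 1) ^ ?k (edges G) * ((x - 1) ^ (?k A - ?k (edges G)) *
        (y - 1) ^ (?k A + card A - card (verts G))) * (y - 1) ^ card (verts G)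
      = ((x - 1) * (y - 1)) ^ ?k A * (y - 1) ^ card A" if "A \<subseteq> edges G" for A
  proof -
    have "(x - 1) ^ ?k (edges G) * (x - 1) ^ (?k A - ?k (edges G)) = (x - 1) ^ ?k A"
      using num_components_antimono [OF that] by (simp flip: power_add)
    moreover have "(y - 1) ^ (?k A + card A - card (verts G)) * (y - 1) ^ card (verts G)
        = (y - 1) ^ ?k A * (y - 1) ^ card A"
      using card_verts_le [OF that] by (simp flip: power_add)
    ultimately show ?thesis
      by (metis (no_types) mult.assoc power_mult_distrib)
  qed
  then show ?thesis
    by (simp add: tutte_def sum_distrib_left sum_distrib_right)
qed

text \<open>Constancy along the edges in \<open>A\<close> is constancy on connected components, so
  these colourings correspond to functions from the components to \<open>C\<close>.\<close>

lemma card_colourings: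
  assumes A: "A \<subseteq> edges G"
  shows "card {\<sigma> \<in> verts G \<rightarrow>\<^sub>E C. \<forall>(u, v)\<in>adjacency G A. \<sigma> u = \<sigma> v}
    = card C ^ num_components G A"
proof -
  let ?V = "verts G" and ?R = "(adjacency G A)\<^sup>*"
  let ?Q = "?V // ?R" and ?S = "{\<sigma> \<in> verts G \<rightarrow>\<^sub>E C. \<forall>(u, v)\<in>adjacency G A. \<sigma> u = \<sigma> v}"
  let ?\<phi> = "\<lambda>g. \<lambda>u\<in>?V. g (?R `` {u})"
  have class_eq: "?R `` {u} = ?R `` {v}" if "(u, v) \<in> adjacency G A" for u v
    using that by (simp add: connected_class_eq_iff r_into_rtrancl)
  have "bij_betw ?\<phi> (?Q \<rightarrow>\<^sub>E C) ?S"
    unfolding bij_betw_def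
  proof (intro conjI equalityI subsetI)
    show "inj_on ?\<phi> (?Q \<rightarrow>\<^sub>E C)"
    proof (rule inj_onI)
      fix g h assume g: "g \<in> ?Q \<rightarrow>\<^sub>E C" and h: "h \<in> ?Q \<rightarrow>\<^sub>E C" and eq: "?\<phi> g = ?\<phi> h"
      show "g = h"
      proof (rule PiE_ext [OF g h])
        fix X assume "X \<in> ?Q"
        then obtain u where "u \<in> ?V" "X = ?R `` {u}" by (auto simp: quotient_def)
        then show "g X = h X" using fun_cong [OF eq, of u] by simp
      qed
    qed
  next
    fix \<sigma> assume "\<sigma> \<in> ?\<phi> ` (?Q \<rightarrow>\<^sub>E C)"
    then obtain g where g: "g \<in> ?Q \<rightarrow>\<^sub>E C" and \<sigma>: "\<sigma> = ?\<phi> g" by auto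
    have "\<sigma> u = \<sigma> v" if uv: "(u, v) \<in> adjacency G A" for u v
    proof -
      \<comment> \<open>Off \<open>?V\<close> a restricted function takes one default value, so the
        ends must be both inside or both outside.\<close>
      have "u \<in> ?V \<longleftrightarrow> v \<in> ?V"
        using connected_in_verts [OF A] uv by (meson connected_sym r_into_rtrancl)
      then show ?thesis using class_eq [OF uv] by (simp add: \<sigma> restrict_def)
    qed
    moreover have "\<sigma> \<in> ?V \<rightarrow>\<^sub>E C"
      using g by (auto simp: \<sigma> PiE_iff quotientI)
    ultimately show "\<sigma> \<in> ?S" by auto
  next
    fix \<sigma> assume \<sigma>: "\<sigma> \<in> ?S"
    have const: "\<sigma> u = \<sigma> v" if "(u, v) \<in> ?R" for u v
      using that by induction (use \<sigma> in auto)
    define g where "g = (\<lambda>X\<in>?Q. \<sigma> (SOME u. u \<in> X))"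
    have g: "g (?R `` {u}) = \<sigma> u" if "u \<in> ?V" for u
    proof -
      have "(SOME v. v \<in> ?R `` {u}) \<in> ?R `` {u}" by (rule someI [of _ u]) auto
      then show ?thesis using const that by (auto simp: g_def quotientI)
    qed
    have "g \<in> ?Q \<rightarrow>\<^sub>E C"
    proof (rule PiE_I)
      fix X assume "X \<in> ?Q"
      then obtain u where "u \<in> ?V" "X = ?R `` {u}" by (auto simp: quotient_def)
      then show "g X \<in> C" using \<sigma> g by auto
    qed (simp add: g_def)
    moreover have "?\<phi> g = \<sigma>"
      using \<sigma> g by (auto simp: fun_eq_iff PiE_iff extensional_def)
    ultimately show "\<sigma> \<in> ?\<phi> ` (?Q \<rightarrow>\<^sub>E C)" by blast
  qed
  then have "card ?S = card (?Q \<rightarrow>\<^sub>E C)" by (simp add: bij_betw_same_card)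
  then show ?thesis
    by (simp add: card_PiE finite_components num_components_def)
qed

text \<open>Each power of \<open>c\<close> counts colourings constant along \<open>A\<close>. After
  the sums are exchanged, \<open>A\<close> ranges over the sets of monochromatic edges of a fixed
  colouring, and the binomial expansion gives \<open>1 + z\<close> to the number of those
  edges.\<close>

lemma sum_edge_sets_eq_sum_colourings:
  fixes z :: "'a::comm_ring_1"
  shows "(\<Sum>A\<in>Pow (edges G). of_nat c ^ num_components G A * z ^ card A)
    = (\<Sum>\<sigma>\<in>verts G \<rightarrow>\<^sub>E {..<c}. \<Prod>a<c. (1 + z) ^ card {e\<in>edges G. ends G e \<subseteq> {u\<in>verts G. \<sigma> u = a}})"
proof -
  let ?Col = "verts G \<rightarrow>\<^sub>E {..<c}" and ?E = "edges G"
  \<comment> \<open>The monochromatic edges, split by colour so that their number becomes a sum over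
    colour classes.\<close>
  define mono where "mono = (\<lambda>\<sigma>. \<Union>a<c. {e\<in>?E. ends G e \<subseteq> {u\<in>verts G. \<sigma> u = a}})"
  have fin: "finite ?Col" using finite_verts by (simp add: finite_PiE)
  have mono_iff: "A \<subseteq> mono \<sigma> \<longleftrightarrow> (\<forall>(u, v)\<in>adjacency G A. \<sigma> u = \<sigma> v)"
    if A: "A \<subseteq> ?E" and \<sigma>: "\<sigma> \<in> ?Col" for A \<sigma>
  proof
    assume "A \<subseteq> mono \<sigma>"
    then show "\<forall>(u, v)\<in>adjacency G A. \<sigma> u = \<sigma> v"
      by (fastforce simp: mono_def adjacency_def)
  next
    assume const: "\<forall>(u, v)\<in>adjacency G A. \<sigma> u = \<sigma> v"
    show "A \<subseteq> mono \<sigma>"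
    proof
      fix e assume e: "e \<in> A"
      then obtain u v where uv: "u \<in> verts G" "v \<in> verts G" "ends G e = {u, v}"
        using ends [of e] A by auto
      then have "(u, v) \<in> adjacency G A" using e by (auto simp: adjacency_def)
      then have "\<sigma> u = \<sigma> v" using const by auto
      moreover have "\<sigma> u < c" using \<sigma> uv by (auto simp: PiE_iff)
      ultimately show "e \<in> mono \<sigma>" using uv e A by (auto simp: mono_def)
    qed
  qed
  have "(\<Sum>A\<in>Pow ?E. of_nat c ^ num_components G A * z ^ card A)
      = (\<Sum>A\<in>Pow ?E. \<Sum>\<sigma>\<in>?Col. if A \<subseteq> mono \<sigma> then z ^ card A else 0)"
  proof (intro sum.cong refl)
    fix A assume "A \<in> Pow ?E"
    then have A: "A \<subseteq> ?E" by simp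
    have "(of_nat c :: 'a) ^ num_components G A
        = of_nat (card {\<sigma> \<in> ?Col. \<forall>(u, v)\<in>adjacency G A. \<sigma> u = \<sigma> v})"
      by (simp add: card_colourings [OF A])
    also have "{\<sigma> \<in> ?Col. \<forall>(u, v)\<in>adjacency G A. \<sigma> u = \<sigma> v} = {\<sigma> \<in> ?Col. A \<subseteq> mono \<sigma>}"
      using mono_iff [OF A] by blast
    finally show "of_nat c ^ num_components G A * z ^ card A
        = (\<Sum>\<sigma>\<in>?Col. if A \<subseteq> mono \<sigma> then z ^ card A else 0)"
      using fin by (simp add: sum.If_cases Int_def)
  qed
  also have "\<dots> = (\<Sum>\<sigma>\<in>?Col. \<Sum>A\<in>Pow ?E. if A \<subseteq> mono \<sigma> then z ^ card A else 0)"
    by (rule sum.swap)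
  also have "\<dots> = (\<Sum>\<sigma>\<in>?Col. \<Prod>a<c. (1 + z) ^ card {e\<in>?E. ends G e \<subseteq> {u\<in>verts G. \<sigma> u = a}})"
  proof (intro sum.cong refl)
    fix \<sigma> assume "\<sigma> \<in> ?Col"
    have sub: "mono \<sigma> \<subseteq> ?E" by (auto simp: mono_def)
    have "(\<Sum>A\<in>Pow ?E. if A \<subseteq> mono \<sigma> then z ^ card A else 0) = (\<Sum>A\<in>Pow (mono \<sigma>). z ^ card A)"
      using finite_edges sub by (intro sum.mono_neutral_cong_right) auto
    also have "\<dots> = (z + 1) ^ card (mono \<sigma>)"
      using prod_add [OF finite_subset [OF sub finite_edges], of "\<lambda>_. z" "\<lambda>_. 1"] by simp
    also have "card (mono \<sigma>) = (\<Sum>a<c. card {e\<in>?E. ends G e \<subseteq> {u\<in>verts G. \<sigma> u = a}})"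
      unfolding mono_def
    proof (rule card_UN_disjoint)
      \<comment> \<open>Every edge has an end point, and that vertex has only one colour.\<close>
      show "\<forall>a\<in>{..<c}. \<forall>b\<in>{..<c}. a \<noteq> b \<longrightarrow>
        {e\<in>?E. ends G e \<subseteq> {u\<in>verts G. \<sigma> u = a}} \<inter> {e\<in>?E. ends G e \<subseteq> {u\<in>verts G. \<sigma> u = b}} = {}"
        using ends by fastforce
    qed (simp_all add: finite_edges)
    finally show "(\<Sum>A\<in>Pow ?E. if A \<subseteq> mono \<sigma> then z ^ card A else 0)
        = (\<Prod>a<c. (1 + z) ^ card {e\<in>?E. ends G e \<subseteq> {u\<in>verts G. \<sigma> u = a}})"
      by (simp add: power_sum add.commute)
  qed
  finally show ?thesis .
qed

end

section \<open>Complete multipartite graphs\<close>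

lemma finite_multigraph_complete_multipartite:
  "finite_multigraph (complete_multipartite r l n)"
proof
  let ?K = "complete_multipartite r l n"
  show V: "finite (verts ?K)"
    by (simp add: complete_multipartite_def Let_def)
  have "edges ?K \<subseteq> (SIGMA \<alpha>:verts ?K. SIGMA \<beta>:verts ?K. {..<l (fst \<alpha>) (fst \<beta>)})"
    by (auto simp: complete_multipartite_def Let_def)
  then show "finite (edges ?K)"
    by (rule finite_subset) (intro finite_SigmaI V finite_lessThan)
  show "\<exists>u\<in>verts ?K. \<exists>v\<in>verts ?K. ends ?K e = {u, v}" if "e \<in> edges ?K" for e
    using that by (fastforce simp: complete_multipartite_def Let_def)
qed

text \<open>Edges inside \<open>B\<close> are sorted by the parts \<open>i < j\<close> of their
  ends. Their number depends on \<open>B\<close> only through its profile, so it can serve as a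
  coefficient of a generating series.\<close>

lemma card_induced_edges:
  fixes r l n
  defines "K \<equiv> complete_multipartite r l n"
  assumes B: "B \<subseteq> verts K"
  shows "card {e\<in>edges K. ends K e \<subseteq> B} =
    (\<Sum>(i, j) | 1 \<le> i \<and> i < j \<and> j \<le> r. l i j * lookup (profile fst B) i * lookup (profile fst B) j)"
proof -
  let ?P = "{(i, j). 1 \<le> i \<and> i < j \<and> j \<le> r}" and ?part = "\<lambda>i. {u\<in>B. fst u = i}"
  interpret finite_multigraph K unfolding K_def by (rule finite_multigraph_complete_multipartite)
  have fin: "finite B" using B finite_verts by (rule finite_subset)
  have finP: "finite ?P" by (rule finite_subset [of _ "{1..r} \<times> {1..r}"]) auto
  have eq: "{e\<in>edges K. ends K e \<subseteq> B} = (\<Union>(i, j)\<in>?P. ?part i \<times> ?part j \<times> {..<l i j})"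
  proof (intro equalityI subsetI)
    fix e assume "e \<in> {e\<in>edges K. ends K e \<subseteq> B}"
    then show "e \<in> (\<Union>(i, j)\<in>?P. ?part i \<times> ?part j \<times> {..<l i j})"
      by (auto simp: K_def complete_multipartite_def Let_def)
  next
    fix e assume "e \<in> (\<Union>(i, j)\<in>?P. ?part i \<times> ?part j \<times> {..<l i j})"
    then show "e \<in> {e\<in>edges K. ends K e \<subseteq> B}"
      using B by (auto simp: K_def complete_multipartite_def Let_def)
  qed
  have "card {e\<in>edges K. ends K e \<subseteq> B} = (\<Sum>p\<in>?P. card (case p of (i, j) \<Rightarrow> ?part i \<times> ?part j \<times> {..<l i j}))"
    unfolding eq using fin by (intro card_UN_disjoint finP) auto
  also have "\<dots> = (\<Sum>(i, j)\<in>?P. l i j * lookup (profile fst B) i * lookup (profile fst B) j)"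
    by (intro sum.cong refl) (auto simp: card_cartesian_product lookup_profile [OF fin] mult_ac)
  finally show ?thesis .
qed

lemma profile_verts_complete_multipartite:
  assumes "n \<in> multi_indices r"
  shows "profile fst (verts (complete_multipartite r l (lookup n))) = n"
proof (rule poly_mapping_eqI)
  fix j
  let ?V = "SIGMA j:{1..r}. {..<lookup n j}"
  have "{u\<in>?V. fst u = j} = (if j \<in> {1..r} then {j} \<times> {..<lookup n j} else {})"
    by auto
  moreover have "lookup n j = 0" if "j \<notin> {1..r}"
    using that assms by (auto simp: multi_indices_def in_keys_iff)
  ultimately have "card {u\<in>?V. fst u = j} = lookup n j"
    by (simp add: card_cartesian_product)
  then show "lookup (profile fst (verts (complete_multipartite r l (lookup n)))) j = lookup n j"
    by (simp add: complete_multipartite_def Let_def lookup_profile)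
qed

theorem theorem4p3:
  fixes r :: nat
    and l :: "nat \<Rightarrow> nat \<Rightarrow> nat"
    and x y :: "'a::field_char_0"
  assumes "r \<ge> 2"
    and "y \<noteq> 1"
  shows
    "1 + exp_gen_series (multi_indices r - {0})
           (\<lambda>n. let K = complete_multipartite r l (lookup n) in
                (x - 1) ^ num_components K (edges K) * tutte K x y)
     = mfps_powr
         (exp_gen_series (multi_indices r)
           (\<lambda>m. y ^ (\<Sum>(i, j) | 1 \<le> i \<and> i < j \<and> j \<le> r. l i j * lookup m i * lookup m j) *
                (y - 1) powi (- int (total_degree m))))
         ((x - 1) * (y - 1))"
    (is "?lhs = mfps_powr ?f ?q")
proof (rule mfps_eqI)
  fix n :: "nat \<Rightarrow>\<^sub>0 nat"
  have y: "y - 1 \<noteq> 0" using assms by simp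
  define E where "E = (\<lambda>m. \<Sum>(i, j) | 1 \<le> i \<and> i < j \<and> j \<le> r. l i j * lookup m i * lookup m j)"
  \<comment> \<open>Extended by 0 off the index set, like the coefficients of
    \<open>exp_gen_series\<close>; at the profile of a vertex set it is the weight of a colour
    class.\<close>
  define w where "w = (\<lambda>m. if m \<in> multi_indices r then y ^ E m / (y - 1) ^ total_degree m else 0)"
  have f: "?f = Abs_mfps (\<lambda>m. w m / mfact m)"
    unfolding exp_gen_series_def
    by (intro arg_cong [of _ _ Abs_mfps] ext)
      (simp add: w_def E_def mfact_def power_int_minus divide_inverse)
  have zero: "0 \<in> multi_indices r" by (simp add: multi_indices_def)
  have f0: "mfps_nth ?f 0 = 1"
    unfolding f by (simp add: w_def zero E_def mfact_def)
  show "mfps_nth ?lhs n = mfps_nth (mfps_powr ?f ?q) n"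
  proof (cases "n \<in> multi_indices r")
    case False
    then have "n \<noteq> 0" using zero by auto
    \<comment> \<open>In every splitting of \<open>n\<close> one part involves a variable outside
      \<open>{1..r}\<close>, so no power of the base has a coefficient at \<open>n\<close> and the
      zero polynomial interpolates.\<close>
    have "mfps_nth (?f ^ c) n = poly 0 (of_nat c)" for c
    proof -
      have "mfps_nth (?f ^ c) n = 0" using False
      proof (induction c arbitrary: n)
        case 0
        then show ?case using zero by auto
      next
        case (Suc c)
        have "mfps_nth ?f k * mfps_nth (?f ^ c) m = 0" if "(k, m) \<in> splittings n" for k m
        proof -
          have "keys n \<subseteq> keys k \<union> keys m"
            using that Poly_Mapping.keys_add [of k m] by (auto simp: splittings_def)
          then have "k \<notin> multi_indices r \<or> m \<notin> multi_indices r"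
            using Suc.prems by (auto simp: multi_indices_def)
          then show ?thesis using Suc.IH by (auto simp: exp_gen_series_def)
        qed
        then show ?case by (auto simp: mfps_nth_mult intro!: sum.neutral)
      qed
      then show ?thesis by simp
    qed
    from mfps_nth_powr_eqI [OF f0 this] show ?thesis
      using False \<open>n \<noteq> 0\<close> by (simp add: exp_gen_series_def)
  next
    case n: True
    define K where "K = complete_multipartite r l (lookup n)"
    interpret finite_multigraph K unfolding K_def by (rule finite_multigraph_complete_multipartite)
    have prof: "profile fst (verts K) = n"
      unfolding K_def by (rule profile_verts_complete_multipartite [OF n])
    have card_V: "card (verts K) = total_degree n"
      using total_degree_profile [OF finite_verts, of fst] by (simp add: prof)
    \<comment> \<open>The Fortuin--Kasteleyn sum with \<open>q\<close> free: at
      \<open>of_nat c\<close> it is a weighted count of colourings, at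
      \<open>(x - 1) * (y - 1)\<close> the Tutte polynomial up to explicit factors.\<close>
    define S where "S = (\<lambda>q :: 'a. \<Sum>A\<in>Pow (edges K). q ^ num_components K A * (y - 1) ^ card A)"
    have w_part: "w (profile fst B) = y ^ card {e\<in>edges K. ends K e \<subseteq> B} / (y - 1) ^ card B"
      if B: "B \<subseteq> verts K" for B
    proof -
      have fin: "finite B" using B finite_verts by (rule finite_subset)
      have "fst ` verts K \<subseteq> {1..r}" by (auto simp: K_def complete_multipartite_def Let_def)
      then have "profile fst B \<in> multi_indices r"
        using B by (auto simp: multi_indices_def keys_profile [OF fin])
      then show ?thesis
        using card_induced_edges [OF B [unfolded K_def]]
        by (simp add: w_def E_def K_def total_degree_profile [OF fin])
    qed
    have "S (of_nat c) = mfact n * (y - 1) ^ total_degree n * mfps_nth (?f ^ c) n" for c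
    proof -
      \<comment> \<open>The colour classes partition the vertices, so the denominators of their
        weights multiply to \<open>(y - 1) ^ card (verts K)\<close>.\<close>
      have "(\<Prod>a<c. w (profile fst {u\<in>verts K. \<sigma> u = a})) * (y - 1) ^ card (verts K)
          = (\<Prod>a<c. y ^ card {e\<in>edges K. ends K e \<subseteq> {u\<in>verts K. \<sigma> u = a}})"
        if \<sigma>: "\<sigma> \<in> verts K \<rightarrow>\<^sub>E {..<c}" for \<sigma>
      proof -
        have "verts K = (\<Union>a<c. {u\<in>verts K. \<sigma> u = a})"
          using \<sigma> by (auto simp: PiE_iff)
        then have "card (verts K) = card (\<Union>a<c. {u\<in>verts K. \<sigma> u = a})" by simp
        also have "\<dots> = (\<Sum>a<c. card {u\<in>verts K. \<sigma> u = a})"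
          using finite_verts by (intro card_UN_disjoint) auto
        finally have "(y - 1) ^ card (verts K) = (\<Prod>a<c. (y - 1) ^ card {u\<in>verts K. \<sigma> u = a})"
          by (simp add: power_sum)
        then show ?thesis
          using y by (simp add: w_part flip: prod.distrib)
      qed
      then have "S (of_nat c) = (\<Sum>\<sigma>\<in>verts K \<rightarrow>\<^sub>E {..<c}.
          (\<Prod>a<c. w (profile fst {u\<in>verts K. \<sigma> u = a})) * (y - 1) ^ card (verts K))"
        by (simp add: S_def sum_edge_sets_eq_sum_colourings)
      also have "\<dots> = mfact n * mfps_nth (?f ^ c) n * (y - 1) ^ total_degree n"
        unfolding f by (simp add: sum_colourings [OF finite_verts] prof card_V flip: sum_distrib_right)
      finally show ?thesis by (simp add: mult_ac)
    qed
    \<comment> \<open>\<open>S\<close> as a polynomial in \<open>q\<close>, rescaled so that its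
      values at natural numbers are the coefficients of the powers of the base.\<close>
    moreover define p where "p = (\<Sum>A\<in>Pow (edges K).
        monom ((y - 1) ^ card A / (mfact n * (y - 1) ^ total_degree n)) (num_components K A))"
    have poly_p: "poly p q = S q / (mfact n * (y - 1) ^ total_degree n)" for q
      by (simp add: p_def S_def poly_sum poly_monom sum_divide_distrib mult_ac)
    ultimately have "mfps_nth (?f ^ c) n = poly p (of_nat c)" for c
      using y by simp
    from mfps_nth_powr_eqI [OF f0 this]
    have "mfps_nth (mfps_powr ?f ?q) n = S ?q / (mfact n * (y - 1) ^ total_degree n)"
      by (simp only: poly_p)
    also have "S ?q = (x - 1) ^ num_components K (edges K) * tutte K x y * (y - 1) ^ total_degree n"
      by (simp add: S_def tutte_eq_sum flip: card_V)
    also have "\<dots> / (mfact n * (y - 1) ^ total_degree n)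
        = (x - 1) ^ num_components K (edges K) * tutte K x y / mfact n"
      using y by simp
    also have "\<dots> = mfps_nth ?lhs n"
    proof (cases "n = 0")
      \<comment> \<open>The series on the left omits \<open>n = 0\<close>; its separate summand 1
        agrees with the value 1 for the empty graph.\<close>
      case True
      then have "verts K = {}" "edges K = {}"
        by (auto simp: K_def complete_multipartite_def Let_def)
      then show ?thesis
        using True by (simp add: tutte_def exp_gen_series_def mfact_def)
    next
      case False
      then show ?thesis
        using n by (simp add: exp_gen_series_def Let_def mfact_def K_def)
    qed
    finally show ?thesis by simp
  qed
qed

end
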